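(* Let $l,t,s,n$ be integers with $2l+2\leq 2s\leq 2l+t-2$, $l\geq 3$, $t\geq 4$, $t\geq l$, and $n\geq\max\left\{2\binom{3s}{2},\ s+(t-1)\binom{s}{l}+1\right\}$. For integers $x$ let $$F_1(x)=(l-1)n+(t-1)\binom{x}{l}+\binom{2(s-x)+1}{2}-\left\lceil\frac{x(l-1)}{2}\right\rceil.$$ Then $ex(n,\{K_{l,t},M_{s+1}\})=\max\{F_1(l),F_1(s)\}$.
   Context: All graphs are finite and simple. $ex(n,\mathscr{F})$ is the maximum number of edges of an $n$-vertex graph containing no member of $\mathscr{F}$ as a subgraph. $K_{l,t}$ is the complete bipartite graph with parts of sizes $l,t$; $M_{s+1}$ is the matching of $s+1$ disjoint edges. *)

theory Defs
  imports Complex_Main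
begin

definition simple_graph_on :: "'a set \<Rightarrow> 'a set set \<Rightarrow> bool" where
  "simple_graph_on V E \<longleftrightarrow>
     (\<forall>e\<in>E. \<exists>u v. u \<in> V \<and> v \<in> V \<and> u \<noteq> v \<and> e = {u, v})"

definition contains_K :: "'a set set \<Rightarrow> nat \<Rightarrow> nat \<Rightarrow> bool" where
  "contains_K E l t \<longleftrightarrow>
     (\<exists>A B. finite A \<and> finite B \<and> A \<inter> B = {} \<and> card A = l \<and> card B = t \<and>
            (\<forall>a\<in>A. \<forall>b\<in>B. {a, b} \<in> E))"

definition contains_M :: "'a set set \<Rightarrow> nat \<Rightarrow> bool" where
  "contains_M E k \<longleftrightarrow>
     (\<exists>M. M \<subseteq> E \<and> finite M \<and> card M = k \<and>
          (\<forall>e\<in>M. \<forall>f\<in>M. e \<noteq> f \<longrightarrow> e \<inter> f = {}))"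

definition ex_KM :: "nat \<Rightarrow> nat \<Rightarrow> nat \<Rightarrow> nat \<Rightarrow> nat" where
  "ex_KM n l t k = Max {card E | E. simple_graph_on {..<n} E \<and>
                         \<not> contains_K E l t \<and> \<not> contains_M E k}"

definition F1 :: "nat \<Rightarrow> nat \<Rightarrow> nat \<Rightarrow> nat \<Rightarrow> nat \<Rightarrow> int" where
  "F1 n l t s x = (int l - 1) * int n + (int t - 1) * int (x choose l)
      + int ((2 * (s - x) + 1) choose 2)
      - \<lceil>real (x * (l - 1)) / 2\<rceil>"

end

theory Submission
  imports Defs
begin

text \<open>
  The maximum is always \<open>F1(s)\<close>, and there is enough slack below it to avoid the Tutte--Berge formula.
  Take a maximal set \<open>X\<close> such that \<open>G - X\<close> has no matching of size \<open>s - |X| + 1\<close>, and put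
  \<open>j = s - |X|\<close>. All degrees in \<open>G - X\<close> are then at most \<open>2j\<close>, so \<open>G - X\<close> has at most
  \<open>(6j\<^sup>2 - j) / 2\<close> edges (3 if \<open>j = 1\<close>). Since every \<open>l\<close>-subset of \<open>X\<close> has at most \<open>t - 1\<close>
  common neighbours and \<open>d \<le> (l - 1) + (d choose l)\<close>, the edges meeting \<open>X\<close> number at most
  \<open>(l - 1)(n - |X|) + (l - 1)|X|/2 + (t - 1)(|X| choose l)\<close>. The sum is at most \<open>F1(s)\<close> for
  \<open>|X| \<ge> l\<close> by growth of the binomial coefficient; for \<open>|X| = l - 1\<close> the trivial bound on the edges
  meeting \<open>X\<close> suffices (it is tight for \<open>l = 3\<close>, \<open>s = t = 4\<close>), and for \<open>|X| < l - 1\<close> a term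
  \<open>n\<close> is lost.
\<close>

section \<open>Neighbourhoods and simple graphs\<close>

definition nbrs :: "'a set set \<Rightarrow> 'a set \<Rightarrow> 'a \<Rightarrow> 'a set" where
  "nbrs E W v = {w \<in> W. {v, w} \<in> E}"

lemma nbrs_subset: "nbrs E W v \<subseteq> W"
  by (auto simp: nbrs_def)

lemma finite_nbrs [simp]: "finite W \<Longrightarrow> finite (nbrs E W v)"
  by (simp add: nbrs_def)

lemma simple_graph_onE:
  assumes "simple_graph_on V E" "e \<in> E"
  obtains u v where "u \<in> V" "v \<in> V" "u \<noteq> v" "e = {u, v}"
  using assms(1)[unfolded simple_graph_on_def, rule_format, OF assms(2)] by blast

lemma simple_graph_on_edge:
  assumes "simple_graph_on V E" "{u, v} \<in> E"
  shows "u \<in> V" "v \<in> V" "u \<noteq> v"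
proof -
  obtain a b where ab: "a \<in> V" "b \<in> V" "a \<noteq> b" "{u, v} = {a, b}"
    using assms by (rule simple_graph_onE)
  then have "u = a \<and> v = b \<or> u = b \<and> v = a" by (simp only: doubleton_eq_iff)
  with ab(1-3) show "u \<in> V" "v \<in> V" "u \<noteq> v" by auto
qed

lemma simple_graph_on_loop: "simple_graph_on V E \<Longrightarrow> {v} \<notin> E"
  using simple_graph_on_edge(3)[of V E v v] by auto

lemma simple_graph_on_card2:
  assumes "simple_graph_on V E" "e \<in> E"
  shows "e \<subseteq> V \<and> card e = 2"
  by (rule simple_graph_onE[OF assms]) simp

lemma simple_graph_on_avoid:
  assumes G: "simple_graph_on V E"
  shows "simple_graph_on (V - X) {e \<in> E. e \<inter> X = {}}"
  unfolding simple_graph_on_def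
proof
  fix e assume e: "e \<in> {e \<in> E. e \<inter> X = {}}"
  then have "e \<in> E" by simp
  with G obtain u v where "u \<in> V" "v \<in> V" "u \<noteq> v" "e = {u, v}" by (rule simple_graph_onE)
  with e show "\<exists>u v. u \<in> V - X \<and> v \<in> V - X \<and> u \<noteq> v \<and> e = {u, v}" by blast
qed

lemma simple_graph_on_finite:
  assumes "simple_graph_on V E" "finite V"
  shows "finite E"
proof (rule finite_subset)
  show "E \<subseteq> Pow V" using simple_graph_on_card2[OF assms(1)] by blast
qed (use assms in simp)

section \<open>Double counting of edges and of common neighbours\<close>

lemma nbrs_sum_swap:
  assumes "finite A" "finite B"
  shows "(\<Sum>a\<in>A. card (nbrs E B a)) = (\<Sum>b\<in>B. card (nbrs E A b))"
  unfolding nbrs_def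
  by (rule sum_multicount_gen) (use assms in \<open>auto simp: insert_commute\<close>)

lemma handshake:
  assumes G: "simple_graph_on V E" and V: "finite V"
  shows "(\<Sum>v\<in>V. card (nbrs E V v)) = 2 * card E"
proof -
  have "card (nbrs E V v) = card {e \<in> E. v \<in> e}" if "v \<in> V" for v
  proof (rule bij_betw_same_card)
    show "bij_betw (\<lambda>w. {v, w}) (nbrs E V v) {e \<in> E. v \<in> e}"
    proof (rule bij_betwI')
      fix e assume e: "e \<in> {e \<in> E. v \<in> e}"
      then have "e \<in> E" by simp
      with G obtain a b where "a \<in> V" "b \<in> V" "a \<noteq> b" "e = {a, b}"
        by (rule simple_graph_onE)
      with e have "(if v = a then b else a) \<in> nbrs E V v" "e = {v, if v = a then b else a}"
        by (auto simp: nbrs_def insert_commute)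
      then show "\<exists>w\<in>nbrs E V v. e = {v, w}" by blast
    qed (auto simp: nbrs_def doubleton_eq_iff)
  qed
  then have "(\<Sum>v\<in>V. card (nbrs E V v)) = (\<Sum>v\<in>V. card {e \<in> E. v \<in> e})"
    by simp
  also have "\<dots> = 2 * card E"
  proof (rule sum_multicount)
    show "\<forall>e\<in>E. card {v \<in> V. v \<in> e} = 2"
    proof
      fix e assume "e \<in> E"
      then have "e \<subseteq> V" "card e = 2" using simple_graph_on_card2[OF G] by auto
      moreover from this have "{v \<in> V. v \<in> e} = e" by auto
      ultimately show "card {v \<in> V. v \<in> e} = 2" by simp
    qed
  qed (use V simple_graph_on_finite[OF G V] in auto)
  finally show ?thesis .
qed

text \<open>Double counting of pairs of a vertex \<open>v\<close> and an \<open>l\<close>-subset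
  \<open>A\<close> of \<open>X\<close> inside the neighbourhood of \<open>v\<close>. A set
  \<open>A\<close> occurring with \<open>t\<close> vertices would span a \<open>K\<close> with them;
  the two sides are disjoint because there are no loops.\<close>

lemma sum_choose_nbrs_le:
  assumes G: "simple_graph_on V E" and V: "finite V" and K: "\<not> contains_K E l t"
    and X: "X \<subseteq> V"
  shows "(\<Sum>v\<in>V. card (nbrs E X v) choose l) \<le> (t - 1) * (card X choose l)"
proof -
  define S where "S = {A. A \<subseteq> X \<and> card A = l}"
  have fX: "finite X" using X V finite_subset by blast
  have fS: "finite S" unfolding S_def using fX by simp
  have "(\<Sum>v\<in>V. card (nbrs E X v) choose l) = (\<Sum>v\<in>V. card {A \<in> S. A \<subseteq> nbrs E X v})"
  proof (rule sum.cong[OF refl])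
    fix v
    have "{A \<in> S. A \<subseteq> nbrs E X v} = {A. A \<subseteq> nbrs E X v \<and> card A = l}"
      unfolding S_def nbrs_def by auto
    then show "card (nbrs E X v) choose l = card {A \<in> S. A \<subseteq> nbrs E X v}"
      using n_subsets[of "nbrs E X v" l] fX by simp
  qed
  also have "\<dots> = (\<Sum>A\<in>S. card {v \<in> V. A \<subseteq> nbrs E X v})"
    by (rule sum_multicount_gen) (use V fS in auto)
  also have "\<dots> \<le> (\<Sum>A\<in>S. t - 1)"
  proof (rule sum_mono)
    fix A assume A: "A \<in> S"
    show "card {v \<in> V. A \<subseteq> nbrs E X v} \<le> t - 1"
    proof (rule ccontr)
      assume "\<not> ?thesis"
      then have "t \<le> card {v \<in> V. A \<subseteq> nbrs E X v}" by simp
      then obtain B where B: "B \<subseteq> {v \<in> V. A \<subseteq> nbrs E X v}" "card B = t" "finite B"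
        using obtain_subset_with_card_n by blast
      have "{a, b} \<in> E" if "a \<in> A" "b \<in> B" for a b
      proof -
        have "a \<in> nbrs E X b" using that B(1) by blast
        then show ?thesis by (simp add: nbrs_def insert_commute)
      qed
      moreover from this have "A \<inter> B = {}"
        using simple_graph_on_loop[OF G] by force
      ultimately have "contains_K E l t"
        unfolding contains_K_def using A B(2,3) fX finite_subset
        by (intro exI[of _ A] exI[of _ B]) (auto simp: S_def)
      with K show False by simp
    qed
  qed
  also have "\<dots> = (t - 1) * (card X choose l)"
    using n_subsets[OF fX, of l] by (simp add: S_def mult.commute)
  finally show ?thesis .
qed

text \<open>Turns degrees into counts of \<open>l\<close>-subsets. Both sides agree at
  \<open>d = l\<close>, and each further step raises the right side by
  \<open>d choose (l - 1)\<close>, which is at least 1.\<close>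

lemma le_pred_add_choose:
  assumes "l \<ge> 1"
  shows "d \<le> (l - 1) + (d choose l)"
proof (cases "d \<ge> l")
  case True
  then show ?thesis
  proof (induction d rule: dec_induct)
    case base
    then show ?case using assms by simp
  next
    case (step d)
    obtain l' where l': "l = Suc l'" using assms by (cases l) auto
    have "d choose l' \<ge> 1" using step l' by (simp add: Suc_le_eq zero_less_binomial)
    then show ?case using step l' by simp
  qed
qed simp

section \<open>Matchings and the choice of \<open>X\<close>\<close>

lemma contains_M_mono:
  assumes "contains_M E k" "j \<le> k" "E \<subseteq> E'"
  shows "contains_M E' j"
proof -
  obtain M where M: "M \<subseteq> E" "finite M" "card M = k" "\<forall>e\<in>M. \<forall>f\<in>M. e \<noteq> f \<longrightarrow> e \<inter> f = {}"
    using assms(1) unfolding contains_M_def by blast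
  obtain N where "N \<subseteq> M" "card N = j" "finite N"
    using obtain_subset_with_card_n[of j M] M(3) assms(2) by blast
  then show ?thesis using M assms(3) unfolding contains_M_def by (intro exI[of _ N]) blast
qed

lemma contains_M_insert:
  assumes "M \<subseteq> E" "finite M" "\<forall>e\<in>M. \<forall>f\<in>M. e \<noteq> f \<longrightarrow> e \<inter> f = {}"
    and "e \<in> E" "e \<noteq> {}" "e \<inter> \<Union>M = {}"
  shows "contains_M E (Suc (card M))"
proof -
  have "e \<notin> M" using assms(5,6) by auto
  then have "card (insert e M) = Suc (card M)" using assms(2) by simp
  then show ?thesis unfolding contains_M_def
    using assms by (intro exI[of _ "insert e M"]) blast
qed

lemma card_Union_matching:
  assumes "simple_graph_on V E" "M \<subseteq> E" "finite M" "\<forall>e\<in>M. \<forall>f\<in>M. e \<noteq> f \<longrightarrow> e \<inter> f = {}"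
  shows "card (\<Union>M) = 2 * card M"
proof -
  have c: "card e = 2" if "e \<in> M" for e using simple_graph_on_card2[OF assms(1)] assms(2) that by blast
  have "card (\<Union>M) = sum card M"
    by (rule card_Union_disjoint)
      (use assms(4) c in \<open>auto simp: pairwise_def disjnt_def intro: card_ge_0_finite\<close>)
  then show ?thesis using c by simp
qed

text \<open>Only one end of an edge of a maximum matching can see several unmatched vertices; this is
  what improves on the trivial bound for the number of edges leaving the matching.\<close>
lemma edges_le_of_matching_degree:
  assumes G: "simple_graph_on V E" and V: "finite V" and nM: "\<not> contains_M E (j + 1)"
    and deg: "\<And>v. v \<in> V \<Longrightarrow> card (nbrs E V v) \<le> 2 * j"
  shows "2 * card E \<le> 4 * j * j + j * max 2 (2 * j - 1)"
proof -
  have fE: "finite E" by (rule simple_graph_on_finite[OF G V])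
  define P where "P M \<longleftrightarrow> M \<subseteq> E \<and> (\<forall>e\<in>M. \<forall>f\<in>M. e \<noteq> f \<longrightarrow> e \<inter> f = {})" for M
  have "P {}" by (simp add: P_def)
  moreover have "\<forall>M. P M \<longrightarrow> card M < card E + 1"
    using card_mono[OF fE] by (auto simp: P_def less_Suc_eq_le)
  ultimately obtain M where M: "P M" and max: "\<And>N. P N \<Longrightarrow> card N \<le> card M"
    using ex_has_greatest_nat[of P "{}" card "card E + 1"] by blast
  have ME: "M \<subseteq> E" and disj: "\<forall>e\<in>M. \<forall>f\<in>M. e \<noteq> f \<longrightarrow> e \<inter> f = {}"
    using M by (auto simp: P_def)
  have fM: "finite M" using ME fE finite_subset by blast
  have max': "\<not> contains_M E (Suc (card M))"
  proof
    assume "contains_M E (Suc (card M))"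
    then obtain N where "P N" "card N = Suc (card M)"
      unfolding contains_M_def P_def by blast
    then show False using max by fastforce
  qed
  have Mj: "card M \<le> j"
  proof (rule ccontr)
    assume "\<not> ?thesis"
    then have "contains_M E (j + 1)"
      using contains_M_mono[of E "card M" "j + 1" E] ME fM disj
      unfolding contains_M_def[of E "card M"] by fastforce
    with nM show False by simp
  qed
  define U where "U = \<Union>M"
  define Z where "Z = V - U"
  have UV: "U \<subseteq> V" using ME simple_graph_on_card2[OF G] by (auto simp: U_def)
  have fU: "finite U" and fZ: "finite Z" using UV V finite_subset by (auto simp: Z_def)
  have sumM: "sum f U = (\<Sum>e\<in>M. sum f e)" for f :: "'a \<Rightarrow> nat"
    unfolding U_def using sum.Union_disjoint[of M f] disj fU
    by (metis U_def Union_upper finite_subset comp_def)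
  have Zind: "{v, w} \<notin> E" if "v \<in> Z" "w \<in> Z" for v w
    using contains_M_insert[OF ME fM disj, of "{v, w}"] max' that by (auto simp: Z_def U_def)
  have "2 * card E = (\<Sum>v\<in>U. card (nbrs E V v)) + (\<Sum>v\<in>Z. card (nbrs E V v))"
    using handshake[OF G V] sum.subset_diff[OF UV V, of "\<lambda>v. card (nbrs E V v)"]
    by (simp add: Z_def)
  also have "(\<Sum>v\<in>Z. card (nbrs E V v)) = (\<Sum>v\<in>Z. card (nbrs E U v))"
  proof (rule sum.cong[OF refl])
    fix v assume "v \<in> Z"
    then have "nbrs E V v = nbrs E U v" using UV Zind by (auto simp: nbrs_def Z_def)
    then show "card (nbrs E V v) = card (nbrs E U v)" by simp
  qed
  also have "\<dots> = (\<Sum>v\<in>U. card (nbrs E Z v))" by (rule nbrs_sum_swap[OF fZ fU])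
  also have "(\<Sum>v\<in>U. card (nbrs E V v)) + \<dots> \<le> (\<Sum>e\<in>M. 4 * j) + (\<Sum>e\<in>M. max 2 (2 * j - 1))"
    unfolding sumM
  proof (intro add_mono sum_mono)
    fix e assume e: "e \<in> M"
    then have "e \<in> E" using ME by blast
    with G obtain u v where uv: "u \<in> V" "v \<in> V" "u \<noteq> v" "e = {u, v}"
      by (rule simple_graph_onE)
    show "(\<Sum>v\<in>e. card (nbrs E V v)) \<le> 4 * j"
      using uv deg[of u] deg[of v] by simp
    have small: "card (nbrs E Z p) \<le> max 2 (2 * j - 1) \<and> (card (nbrs E Z p) \<ge> 2 \<longrightarrow> nbrs E Z q = {})"
      if pq: "e = {p, q}" "p \<noteq> q" for p q
    proof
      have pqV: "p \<in> V" "q \<in> V" "q \<in> U" using pq uv e UV by (auto simp: U_def)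
      \<comment> \<open>The partner \<open>q\<close> is a neighbour of \<open>p\<close> outside
        \<open>Z\<close>, which lowers the degree bound \<open>2 * j\<close> by one.\<close>
      have "nbrs E Z p \<subseteq> nbrs E V p - {q}" using pqV by (auto simp: nbrs_def Z_def)
      then have "card (nbrs E Z p) \<le> card (nbrs E V p - {q})" using V by (intro card_mono) auto
      also have "q \<in> nbrs E V p" using pq e ME pqV by (auto simp: nbrs_def)
      then have "card (nbrs E V p - {q}) = card (nbrs E V p) - 1" by simp
      finally show "card (nbrs E Z p) \<le> max 2 (2 * j - 1)" using deg[OF pqV(1)] by linarith
      show "card (nbrs E Z p) \<ge> 2 \<longrightarrow> nbrs E Z q = {}"
      proof (intro impI, rule ccontr)
        assume c: "card (nbrs E Z p) \<ge> 2" and "nbrs E Z q \<noteq> {}"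
        then obtain w where w: "w \<in> nbrs E Z q" by blast
        have "\<not> nbrs E Z p \<subseteq> {w}" using c card_mono[of "{w}" "nbrs E Z p"] by auto
        then obtain x where x: "x \<in> nbrs E Z p" "x \<noteq> w" by blast
        \<comment> \<open>The path \<open>x\<close>, \<open>p\<close>, \<open>q\<close>,
          \<open>w\<close> is augmenting: exchanging \<open>e\<close> for \<open>{p, x}\<close> and
          \<open>{q, w}\<close> enlarges the matching.\<close>
        define N where "N = M - {e}"
        have N: "N \<subseteq> E" "finite N" "\<forall>e\<in>N. \<forall>f\<in>N. e \<noteq> f \<longrightarrow> e \<inter> f = {}"
          using ME fM disj by (auto simp: N_def)
        have cN: "card M = Suc (card N)" using e fM unfolding N_def by (metis card_Suc_Diff1)
        have eN: "e \<inter> f = {}" if "f \<in> N" for f using that disj e by (auto simp: N_def)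
        have NU: "\<Union>N \<subseteq> U" by (auto simp: N_def U_def)
        have pqU: "p \<in> U" "q \<in> U" using pq e by (auto simp: U_def)
        have wx: "w \<in> Z" "x \<in> Z" "{q, w} \<in> E" "{p, x} \<in> E" using w x by (auto simp: nbrs_def)
        then have wxU: "w \<notin> U" "x \<notin> U" by (auto simp: Z_def)
        have d: "{q, w} \<inter> \<Union>N = {}" "{p, x} \<inter> \<Union>N = {}"
          using eN wxU NU pq(1) by blast+
        have nin: "{q, w} \<notin> N" using d by auto
        have d2: "{p, x} \<inter> {q, w} = {}" using pq(2) x(2) pqU wxU by auto
        have "contains_M E (Suc (card (insert {q, w} N)))"
          by (rule contains_M_insert[of _ _ "{p, x}"]) (use N d d2 wx in auto)
        then have "contains_M E (Suc (card M))" using cN nin N(2) by simp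
        with max' show False by simp
      qed
    qed
    have s1: "card (nbrs E Z u) \<le> max 2 (2 * j - 1)" "card (nbrs E Z u) \<ge> 2 \<longrightarrow> nbrs E Z v = {}"
      using small[of u v] uv by auto
    have s2: "card (nbrs E Z v) \<le> max 2 (2 * j - 1)" "card (nbrs E Z v) \<ge> 2 \<longrightarrow> nbrs E Z u = {}"
      using small[of v u] uv by auto
    \<comment> \<open>The 2 in the maximum covers one unmatched neighbour at each end. A larger sum
      forces at least two at one end, hence none at the other.\<close>
    have "card (nbrs E Z u) + card (nbrs E Z v) \<le> max 2 (2 * j - 1)"
    proof (rule ccontr)
      assume c: "\<not> ?thesis"
      then have "card (nbrs E Z u) \<ge> 2 \<or> card (nbrs E Z v) \<ge> 2" by linarith
      then have "card (nbrs E Z v) = 0 \<or> card (nbrs E Z u) = 0"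
        using s1(2) s2(2) by (metis card.empty)
      with c s1(1) s2(1) show False by linarith
    qed
    then show "(\<Sum>v\<in>e. card (nbrs E Z v)) \<le> max 2 (2 * j - 1)"
      using uv by simp
  qed
  also have "\<dots> = card M * (4 * j) + card M * max 2 (2 * j - 1)" by simp
  also have "\<dots> \<le> j * (4 * j) + j * max 2 (2 * j - 1)"
    by (intro add_mono mult_right_mono Mj) auto
  finally show ?thesis by (simp add: mult_ac)
qed

text \<open>Take \<open>X\<close> of maximum size with \<open>Q X\<close>. If \<open>v\<close> had
  more than \<open>2 * j\<close> neighbours outside \<open>X\<close>, maximality would give a
  matching of size \<open>j\<close> avoiding \<open>X\<close> and \<open>v\<close>. It covers only
  \<open>2 * j\<close> vertices, so an edge at \<open>v\<close> extends it to size
  \<open>j + 1\<close>, against \<open>Q X\<close>.\<close>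

lemma matching_barrier:
  assumes G: "simple_graph_on V E" and V: "finite V" and nM: "\<not> contains_M E (s + 1)"
  obtains X where "X \<subseteq> V" "card X \<le> s"
    "2 * card {e \<in> E. e \<inter> X = {}}
      \<le> 4 * (s - card X) * (s - card X) + (s - card X) * max 2 (2 * (s - card X) - 1)"
proof -
  define Q where "Q X \<longleftrightarrow> X \<subseteq> V \<and> card X \<le> s \<and> \<not> contains_M {e \<in> E. e \<inter> X = {}} (s - card X + 1)"
    for X
  have "Q {}" using nM by (simp add: Q_def)
  moreover have "\<forall>X. Q X \<longrightarrow> card X < s + 1" by (simp add: Q_def)
  ultimately obtain X where X: "Q X" and max: "\<And>X'. Q X' \<Longrightarrow> card X' \<le> card X"
    using ex_has_greatest_nat[of Q "{}" card "s + 1"] by blast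
  define H where "H = {e \<in> E. e \<inter> X = {}}"
  define j where "j = s - card X"
  have XV: "X \<subseteq> V" "card X \<le> s" and nH: "\<not> contains_M H (j + 1)"
    using X by (auto simp: Q_def H_def j_def)
  have fX: "finite X" using XV V finite_subset by blast
  have HG: "simple_graph_on (V - X) H"
    unfolding H_def by (rule simple_graph_on_avoid[OF G])
  have "card (nbrs H (V - X) v) \<le> 2 * j" if v: "v \<in> V - X" for v
  proof (rule ccontr)
    assume big: "\<not> ?thesis"
    obtain M where M: "M \<subseteq> H" "finite M" "card M = j" "v \<notin> \<Union>M"
      "\<forall>e\<in>M. \<forall>f\<in>M. e \<noteq> f \<longrightarrow> e \<inter> f = {}"
    \<comment> \<open>For \<open>j = 0\<close> maximality says nothing, since
      \<open>insert v X\<close> already has more than \<open>s\<close> elements; the empty matching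
      serves instead.\<close>
    proof (cases "j = 0")
      case True
      then show ?thesis using that[of "{}"] by simp
    next
      case False
      have c: "card (insert v X) = Suc (card X)" using v fX by simp
      then have "\<not> Q (insert v X)" using max[of "insert v X"] by auto
      then have "contains_M {e \<in> E. e \<inter> insert v X = {}} (s - card (insert v X) + 1)"
        using v XV c False by (simp add: Q_def j_def)
      moreover have "s - card (insert v X) + 1 = j" using c False by (simp add: j_def)
      ultimately have "contains_M {e \<in> E. e \<inter> insert v X = {}} j" by simp
      then obtain M where "M \<subseteq> {e \<in> E. e \<inter> insert v X = {}}" "finite M" "card M = j"
        "\<forall>e\<in>M. \<forall>f\<in>M. e \<noteq> f \<longrightarrow> e \<inter> f = {}"
        unfolding contains_M_def by blast
      then show ?thesis by (intro that[of M]) (auto simp: H_def)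
    qed
    have "card (\<Union>M) = 2 * j" using card_Union_matching[OF HG M(1,2,5)] M(3) by simp
    moreover have "finite (\<Union>M)"
      by (rule finite_subset[of _ "V - X"]) (use simple_graph_on_card2[OF HG] M(1) V in auto)
    ultimately have "\<not> nbrs H (V - X) v \<subseteq> \<Union>M" using big card_mono by fastforce
    then obtain w where w: "w \<in> nbrs H (V - X) v" "w \<notin> \<Union>M" by blast
    have "contains_M H (Suc (card M))"
      by (rule contains_M_insert[of _ _ "{v, w}"]) (use M w in \<open>auto simp: nbrs_def\<close>)
    then show False using nH M(3) by simp
  qed
  then have "2 * card H \<le> 4 * j * j + j * max 2 (2 * j - 1)"
    using edges_le_of_matching_degree[OF HG _ nH] V by simp
  then show ?thesis using that[of X] XV by (simp add: H_def j_def)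
qed

section \<open>Edges meeting \<open>X\<close> and the upper bound\<close>

lemma card_edges_split:
  assumes G: "simple_graph_on V E" and V: "finite V" and X: "X \<subseteq> V"
  shows "2 * card E = (\<Sum>v\<in>X. card (nbrs E X v)) + 2 * (\<Sum>v\<in>V - X. card (nbrs E X v))
    + 2 * card {e \<in> E. e \<inter> X = {}}"
proof -
  define Y where "Y = V - X"
  define H where "H = {e \<in> E. e \<inter> X = {}}"
  have fX: "finite X" and fY: "finite Y" using X V finite_subset by (auto simp: Y_def)
  have HG: "simple_graph_on Y H"
    unfolding H_def Y_def by (rule simple_graph_on_avoid[OF G])
  have HY: "nbrs E Y v = nbrs H Y v" if "v \<in> Y" for v
    using that by (auto simp: nbrs_def H_def Y_def)
  have split: "card (nbrs E V v) = card (nbrs E X v) + card (nbrs E Y v)" for v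
  proof -
    have "nbrs E V v = nbrs E X v \<union> nbrs E Y v" "nbrs E X v \<inter> nbrs E Y v = {}"
      using X by (auto simp: nbrs_def Y_def)
    then show ?thesis using fX fY card_Un_disjoint by (metis finite_nbrs)
  qed
  have "2 * card E = (\<Sum>v\<in>X. card (nbrs E V v)) + (\<Sum>v\<in>Y. card (nbrs E V v))"
    using handshake[OF G V] sum.subset_diff[OF X V, of "\<lambda>v. card (nbrs E V v)"]
    by (simp add: Y_def)
  also have "\<dots> = (\<Sum>v\<in>X. card (nbrs E X v)) + (\<Sum>v\<in>X. card (nbrs E Y v))
      + (\<Sum>v\<in>Y. card (nbrs E X v)) + (\<Sum>v\<in>Y. card (nbrs E Y v))"
    by (simp add: split sum.distrib)
  also have "(\<Sum>v\<in>X. card (nbrs E Y v)) = (\<Sum>v\<in>Y. card (nbrs E X v))"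
    by (rule nbrs_sum_swap[OF fX fY])
  also have "(\<Sum>v\<in>Y. card (nbrs E Y v)) = 2 * card H"
    using handshake[OF HG fY] HY by simp
  finally show ?thesis by (simp add: Y_def H_def)
qed

text \<open>Each degree into \<open>X\<close> is replaced by \<open>l - 1\<close> plus its number of
  \<open>l\<close>-subsets. These subsets are given weight 2 at the vertices of \<open>X\<close> as
  well, so that a single double count over \<open>V\<close> bounds them all.\<close>

lemma sum_nbrs_le_of_K_free:
  assumes G: "simple_graph_on V E" and V: "finite V" and K: "\<not> contains_K E l t"
    and X: "X \<subseteq> V" and l: "l \<ge> 1"
  shows "(\<Sum>v\<in>X. card (nbrs E X v)) + 2 * (\<Sum>v\<in>V - X. card (nbrs E X v))
    \<le> (l - 1) * card X + 2 * (l - 1) * (card V - card X) + 2 * (t - 1) * (card X choose l)"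
proof -
  define d where "d v = card (nbrs E X v)" for v
  have fX: "finite X" using X V finite_subset by blast
  have le: "sum d A \<le> (l - 1) * card A + (\<Sum>v\<in>A. d v choose l)" for A
  proof -
    have "sum d A \<le> (\<Sum>v\<in>A. (l - 1) + (d v choose l))"
      by (intro sum_mono le_pred_add_choose l)
    then show ?thesis by (simp add: sum.distrib mult.commute)
  qed
  have "sum d X \<le> (l - 1) * card X + (\<Sum>v\<in>X. d v choose l)"
    "sum d (V - X) \<le> (l - 1) * (card V - card X) + (\<Sum>v\<in>V - X. d v choose l)"
    using le[of X] le[of "V - X"] card_Diff_subset[OF fX X] by simp_all
  moreover have "(\<Sum>v\<in>V - X. d v choose l) + (\<Sum>v\<in>X. d v choose l) \<le> (t - 1) * (card X choose l)"
    using sum_choose_nbrs_le[OF G V K X] sum.subset_diff[OF X V, of "\<lambda>v. d v choose l"]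
    by (simp add: d_def)
  ultimately have "sum d X + 2 * sum d (V - X) \<le> (l - 1) * card X
      + 2 * ((l - 1) * (card V - card X)) + 2 * ((t - 1) * (card X choose l))"
    by linarith
  then show ?thesis unfolding d_def by (simp only: mult.assoc)
qed

text \<open>Serves the range \<open>card X < l\<close>, where counting \<open>l\<close>-subsets of
  \<open>X\<close> gives nothing.\<close>

lemma sum_nbrs_le_trivial:
  assumes G: "simple_graph_on V E" and V: "finite V" and X: "X \<subseteq> V"
  shows "(\<Sum>v\<in>X. card (nbrs E X v)) + 2 * (\<Sum>v\<in>V - X. card (nbrs E X v))
    \<le> card X * (card X - 1) + 2 * card X * (card V - card X)"
proof -
  have fX: "finite X" using X V finite_subset by blast
  have "(\<Sum>v\<in>X. card (nbrs E X v)) \<le> (\<Sum>v\<in>X. card X - 1)"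
  proof (rule sum_mono)
    fix v assume v: "v \<in> X"
    have "nbrs E X v \<subseteq> X - {v}" using simple_graph_on_loop[OF G] by (auto simp: nbrs_def)
    then have "card (nbrs E X v) \<le> card (X - {v})" using fX by (intro card_mono) auto
    then show "card (nbrs E X v) \<le> card X - 1" using v by simp
  qed
  moreover have "(\<Sum>v\<in>V - X. card (nbrs E X v)) \<le> (\<Sum>v\<in>V - X. card X)"
    by (intro sum_mono card_mono fX nbrs_subset)
  ultimately have "(\<Sum>v\<in>X. card (nbrs E X v)) + 2 * (\<Sum>v\<in>V - X. card (nbrs E X v))
    \<le> card X * (card X - 1) + 2 * ((card V - card X) * card X)"
    using card_Diff_subset[OF fX X] by simp
  then show ?thesis by (simp only: mult_ac)
qed

text \<open>By Pascal's rule each step adds \<open>(x + j) choose (l - 1)\<close>, which is at least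
  \<open>l choose (l - 1) = l\<close>.\<close>

lemma choose_add_ge:
  fixes l x j :: nat
  assumes "2 \<le> l" "l \<le> x"
  shows "(x choose l) + j * l \<le> (x + j) choose l"
proof (induction j)
  case (Suc j)
  obtain k where k: "l = Suc k" using assms by (cases l) auto
  have "l = l choose k" using k by simp
  also have "\<dots> \<le> (x + j) choose k" using assms by (intro binomial_right_mono) simp
  finally show ?case using Suc k by simp
qed simp

text \<open>Doubling keeps the bound integral; the rounding in \<open>F1\<close> is recovered later
  from the integrality of \<open>card E\<close>. The hypotheses say how much one
  \<open>l\<close>-subset is worth against \<open>s - l\<close>, and that \<open>card V\<close> is
  quadratically large in \<open>s\<close>.\<close>

lemma edges_le_of_K_M_free:
  assumes G: "simple_graph_on V E" and V: "finite V"
    and K: "\<not> contains_K E l t" and nM: "\<not> contains_M E (s + 1)"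
    and par: "l < s" "2 * (s - l) + 1 \<le> t - 1" "3 \<le> l" "9 * (s * s) \<le> card V + 3 * s"
  shows "2 * card E + s * (l - 1) \<le> 2 * (l - 1) * card V + 2 * (t - 1) * (s choose l)"
proof -
  obtain X where X: "X \<subseteq> V" "card X \<le> s" and
    H: "2 * card {e \<in> E. e \<inter> X = {}}
      \<le> 4 * (s - card X) * (s - card X) + (s - card X) * max 2 (2 * (s - card X) - 1)"
    by (rule matching_barrier[OF G V nM])
  define n x j T where "n = card V" and "x = card X" and "j = s - card X" and "T = t - 1"
  define h where "h = 2 * card {e \<in> E. e \<inter> X = {}}"
  define w where "w = (\<Sum>v\<in>X. card (nbrs E X v)) + 2 * (\<Sum>v\<in>V - X. card (nbrs E X v))"
  have E2: "2 * card E = w + h" using card_edges_split[OF G V X(1)] by (simp add: w_def h_def)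
  have s: "s = x + j" using X by (simp add: x_def j_def)
  have xn: "x \<le> n" using card_mono[OF V X(1)] by (simp add: x_def n_def)
  then obtain y where y: "n = x + y" using le_Suc_ex by blast
  obtain a where a: "l = Suc a" "2 \<le> a" using par(3) by (cases l) auto
  have h: "h \<le> 4 * (j * j) + j * max 2 (2 * j - 1)"
    using H unfolding h_def j_def by (simp only: mult.assoc)
  have h6: "h \<le> 6 * (j * j)"
  proof -
    have "j * max 2 (2 * j - 1) \<le> 2 * (j * j)" by (cases "j = 0") (auto simp: max_def)
    then show ?thesis using h by linarith
  qed
  have w1: "w \<le> a * x + 2 * a * y + 2 * T * (x choose l)"
    using sum_nbrs_le_of_K_free[OF G V K X(1)] a
    by (simp add: w_def x_def[symmetric] n_def[symmetric] T_def y)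
  have w2: "w \<le> x * (x - 1) + 2 * x * y"
    using sum_nbrs_le_trivial[OF G V X(1)]
    by (simp add: w_def x_def[symmetric] n_def[symmetric] y)
  have goal: "w + h + s * a \<le> 2 * a * n + 2 * T * (s choose l)"
  proof -
    consider "l \<le> x" | "x = a" | "x < a" using a by linarith
    then show ?thesis
    proof cases
      \<comment> \<open>Passing from \<open>x\<close> to \<open>s\<close> gains at least
        \<open>j * l\<close> subsets, each worth \<open>2 * T\<close>. This pays for the
        \<open>6 * (j * j)\<close> from \<open>h\<close> and for \<open>j * a\<close>, the share of
        \<open>s * a\<close> not matched by \<open>a * x\<close>.\<close>
      case 1
      have C: "(x choose l) + j * l \<le> s choose l"
        using choose_add_ge[of l x j] 1 a s by simp
      have T: "2 * j + 1 \<le> T" using par(2) s 1 by (simp add: T_def)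
      have "6 * (j * j) + j * a \<le> 2 * ((2 * j + 1) * (j * l))"
      proof -
        have "j * (j * 3) \<le> j * (j * l)" using par(3) by (intro mult_left_mono) auto
        moreover have "j * a \<le> j * l" using a by simp
        moreover have "2 * ((2 * j + 1) * (j * l)) = 4 * (j * (j * l)) + 2 * (j * l)"
          by (simp add: algebra_simps)
        ultimately show ?thesis by linarith
      qed
      also have "\<dots> \<le> 2 * (T * (j * l))" using T by (intro mult_left_mono mult_right_mono) auto
      finally have 2: "6 * (j * j) + j * a \<le> 2 * (T * (j * l))" .
      have "2 * (T * ((x choose l) + j * l)) \<le> 2 * (T * (s choose l))"
        by (intro mult_left_mono C) auto
      then have "2 * (T * (x choose l)) + 2 * (T * (j * l)) \<le> 2 * (T * (s choose l))"
        by (simp add: algebra_simps)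
      then show ?thesis using 2 w1 h6 by (simp add: s y algebra_simps)
    next
      \<comment> \<open>Now \<open>x choose l = 0\<close> and \<open>k = s - l\<close>. The bound
        \<open>h6\<close> is too weak here: for \<open>a = 2\<close>, \<open>k = 1\<close>,
        \<open>T = 3\<close> the estimate for \<open>h\<close> has to be exact to the unit.\<close>
      case 2
      obtain k where k: "j = Suc k" "1 \<le> k" using par(1) s 2 a by (cases j) auto
      have "max 2 (2 * j - 1) = 2 * k + 1" using k by simp
      then have h': "h \<le> 4 * (Suc k * Suc k) + Suc k * (2 * k + 1)" using h k by simp
      have C: "1 + k * l \<le> s choose l"
        using choose_add_ge[of l l k] a s k 2 by simp
      have T: "2 * k + 1 \<le> T" using par(2) s 2 a k by (simp add: T_def)
      \<comment> \<open>After these shifts both sides are polynomials in \<open>a'\<close> and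
        \<open>k'\<close>, and the inequality holds coefficient by coefficient, with constant term
        24 on both sides.\<close>
      obtain a' where a': "a = a' + 2" using a le_Suc_ex by (metis add.commute)
      obtain k' where k': "k = k' + 1" using k le_Suc_ex by (metis add.commute)
      have "a * k + 4 * (Suc k * Suc k) + Suc k * (2 * k + 1) \<le> 2 * ((2 * k + 1) * (1 + k * l))"
        unfolding a a' k' by (simp add: algebra_simps)
      also have "\<dots> \<le> 2 * (T * (1 + k * l))" using T by (intro mult_left_mono mult_right_mono) auto
      also have "\<dots> \<le> 2 * (T * (s choose l))" by (intro mult_left_mono C) auto
      finally have "a * k + h \<le> 2 * (T * (s choose l))" using h' by linarith
      moreover have "w + a \<le> a * a + 2 * a * y"
      proof -
        have "a * (a - 1) + a = a * a" using a by (cases a) auto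
        moreover have "w \<le> a * (a - 1) + 2 * a * y" using w2 2 by simp
        ultimately show ?thesis by linarith
      qed
      ultimately show ?thesis using 2 by (simp add: s y k algebra_simps)
    next
      \<comment> \<open>Here \<open>x + 1 \<le> a\<close> leaves \<open>2 * n\<close> to spare,
        which absorbs \<open>h + s * a\<close>, a quantity of at most
        \<open>7 * (s * s)\<close>.\<close>
      case 3
      have "w \<le> 2 * x * n"
      proof -
        have "x * (x - 1) \<le> 2 * x * x" by (simp add: mult_le_mono)
        then show ?thesis using w2 by (simp add: y algebra_simps)
      qed
      also have "2 * x * n + 2 * n \<le> 2 * a * n"
      proof -
        have "Suc x * n \<le> a * n" using 3 by (intro mult_right_mono) auto
        then show ?thesis by simp
      qed
      finally have "w + 2 * n \<le> 2 * a * n" by simp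
      moreover have "h + s * a \<le> 2 * n"
      proof -
        have "j * j \<le> s * s" using s by (intro mult_mono) auto
        moreover have "s * a \<le> s * s" using par a by (intro mult_left_mono) auto
        moreover have "s * 4 \<le> s * s" using par by (intro mult_left_mono) auto
        ultimately show ?thesis using h6 par(4) unfolding n_def by linarith
      qed
      ultimately show ?thesis by linarith
    qed
  qed
  then show ?thesis using E2 a by (simp add: n_def T_def)
qed

section \<open>Nearly regular graphs and the extremal graph\<close>

lemma simple_graph_on_insert:
  "simple_graph_on V E \<Longrightarrow> u \<in> V \<Longrightarrow> v \<in> V \<Longrightarrow> u \<noteq> v \<Longrightarrow> simple_graph_on V (insert {u, v} E)"
  unfolding simple_graph_on_def by blast

lemma simple_graph_on_subset:
  "simple_graph_on V E \<Longrightarrow> F \<subseteq> E \<Longrightarrow> simple_graph_on V F"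
  unfolding simple_graph_on_def by blast

lemma nbrs_insert:
  assumes "u \<in> W" "v \<in> W"
  shows "nbrs (insert {u, v} E) W x
    = nbrs E W x \<union> (if x = u then {v} else {}) \<union> (if x = v then {u} else {})"
  using assms by (auto simp: nbrs_def doubleton_eq_iff)

lemma card_nbrs_insert_le:
  assumes "finite W" "u \<in> W" "v \<in> W" "u \<noteq> v"
  shows "card (nbrs (insert {u, v} E) W x) \<le> card (nbrs E W x) + (if x = u \<or> x = v then 1 else 0)"
proof -
  have "card (nbrs E W x \<union> {y}) \<le> card (nbrs E W x) + 1" for y
    using card_Un_le[of "nbrs E W x" "{y}"] by simp
  then show ?thesis using assms by (auto simp: nbrs_insert)
qed

text \<open>Induction on the number of edges. If no edge can be added between two deficient vertices,
  choose deficient \<open>u\<close>, \<open>v\<close> (equal if \<open>u\<close> misses two edges), a vertex \<open>a\<close> not adjacent to \<open>u\<close> and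
  a neighbour \<open>b\<close> of \<open>a\<close> not adjacent to \<open>v\<close>, and replace \<open>ab\<close> by \<open>ua\<close> and \<open>vb\<close>.\<close>
lemma ex_graph_bounded_degree:
  assumes V: "finite V" and r: "r < card V"
  shows "2 * m \<le> card V * r \<Longrightarrow>
    \<exists>E. simple_graph_on V E \<and> card E = m \<and> (\<forall>v\<in>V. card (nbrs E V v) \<le> r)"
proof (induction m)
  case 0
  show ?case by (intro exI[of _ "{}"]) (auto simp: simple_graph_on_def nbrs_def)
next
  case (Suc m)
  then obtain E where G: "simple_graph_on V E" and m: "card E = m"
    and deg: "\<And>v. v \<in> V \<Longrightarrow> card (nbrs E V v) \<le> r" by auto
  define d where "d v = card (nbrs E V v)" for v
  have fE: "finite E" by (rule simple_graph_on_finite[OF G V])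
  have sumd: "sum d V + 2 \<le> card V * r"
    using handshake[OF G V] Suc.prems m by (simp add: d_def)
  have add: ?case if uv: "u \<in> V" "v \<in> V" "u \<noteq> v" "{u, v} \<notin> E" "d u < r" "d v < r" for u v
  proof (intro exI[of _ "insert {u, v} E"] conjI ballI)
    show "simple_graph_on V (insert {u, v} E)" using G uv by (intro simple_graph_on_insert)
    show "card (insert {u, v} E) = Suc m" using uv fE m by simp
    fix x assume "x \<in> V"
    then show "card (nbrs (insert {u, v} E) V x) \<le> r"
      using card_nbrs_insert_le[OF V uv(1-3), of E x] deg[of x] uv(5,6)
      by (auto simp: d_def split: if_splits)
  qed
  have "\<exists>u\<in>V. d u < r"
  proof (rule ccontr)
    assume "\<not> ?thesis"
    then have "card V * r \<le> sum d V" using sum_bounded_below[of V r d] by (simp add: not_less)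
    with sumd show False by simp
  qed
  then obtain u where u: "u \<in> V" "d u < r" by blast
  \<comment> \<open>The degree sum falls short of \<open>card V * r\<close> by at least 2, so either
    a second vertex is deficient or \<open>u\<close> is doubly so.\<close>
  have "\<exists>v\<in>V. d v < r \<and> (v = u \<longrightarrow> d u + 2 \<le> r)"
  proof (rule ccontr)
    assume none: "\<not> ?thesis"
    have rest: "r \<le> d v" if "v \<in> V - {u}" for v
      using none that by (cases "d v < r") auto
    have "\<not> d u + 2 \<le> r" using none u by blast
    then have "r \<le> d u + 1" by simp
    moreover have "card (V - {u}) * r \<le> sum d (V - {u})"
      using sum_bounded_below[of "V - {u}" r d] rest by simp
    moreover have "sum d V = d u + sum d (V - {u})" using V u by (simp add: sum.remove)
    moreover have "card V * r = r + card (V - {u}) * r"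
      using V u card_Suc_Diff1[of V u] by (metis mult_Suc)
    ultimately show False using sumd by linarith
  qed
  then obtain v where v: "v \<in> V" "d v < r" "v = u \<Longrightarrow> d u + 2 \<le> r" by blast
  have "\<not> V \<subseteq> insert u (nbrs E V u)"
  proof
    assume "V \<subseteq> insert u (nbrs E V u)"
    then have "card V \<le> card (insert u (nbrs E V u))" using V by (intro card_mono) auto
    also have "\<dots> \<le> Suc (d u)" using V by (simp add: d_def card_insert_if)
    finally show False using u r by simp
  qed
  then obtain a where a: "a \<in> V" "a \<noteq> u" "{u, a} \<notin> E" by (auto simp: nbrs_def)
  show ?case
  proof (cases "d a < r \<or> (u \<noteq> v \<and> {u, v} \<notin> E)")
    case True
    then show ?thesis using add[of u a] add[of u v] a u v by auto
  next
    case False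
    then have da: "d a = r" and uv: "u \<noteq> v \<Longrightarrow> {u, v} \<in> E"
      using deg[OF a(1)] by (auto simp: d_def)
    have av: "a \<noteq> v" using uv a by auto
    \<comment> \<open>\<open>a\<close> has \<open>r\<close> neighbours and the right side at most
      \<open>r\<close> elements, so inclusion would be equality. But \<open>u\<close> lies on the
      right and is not adjacent to \<open>a\<close>.\<close>
    have "\<not> nbrs E V a \<subseteq> insert v (nbrs E V v)"
    proof
      assume sub: "nbrs E V a \<subseteq> insert v (nbrs E V v)"
      have "insert v (nbrs E V v) \<subseteq> nbrs E V a"
      proof -
        have "card (insert v (nbrs E V v)) \<le> card (nbrs E V a)"
          using v da V by (simp add: d_def card_insert_if)
        then show ?thesis using sub V card_seteq[of "insert v (nbrs E V v)" "nbrs E V a"] by simp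
      qed
      moreover have "u \<in> insert v (nbrs E V v)" using uv u by (auto simp: nbrs_def insert_commute)
      moreover have "u \<notin> nbrs E V a" using a by (simp add: nbrs_def insert_commute)
      ultimately show False by blast
    qed
    then obtain b where b: "b \<in> V" "{a, b} \<in> E" "b \<noteq> v" "{v, b} \<notin> E" by (auto simp: nbrs_def)
    have bu: "b \<noteq> u" using a b by (auto simp: insert_commute)
    have ab: "a \<noteq> b" using simple_graph_on_edge[OF G b(2)] by simp
    define E0 where "E0 = E - {{a, b}}"
    define E1 where "E1 = insert {u, a} E0"
    define E2 where "E2 = insert {v, b} E1"
    have "simple_graph_on V E0" by (rule simple_graph_on_subset[OF G]) (auto simp: E0_def)
    then have "simple_graph_on V E1" unfolding E1_def
      by (rule simple_graph_on_insert) (use u a in auto)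
    then have G2: "simple_graph_on V E2" unfolding E2_def
      by (rule simple_graph_on_insert) (use v b in auto)
    have "Suc (card E0) = m" using b fE m unfolding E0_def by (metis card_Suc_Diff1)
    moreover have "card E1 = Suc (card E0)" using a fE by (simp add: E1_def E0_def)
    moreover have "{v, b} \<notin> E1" using av b bu ab by (auto simp: E1_def E0_def doubleton_eq_iff)
    then have "card E2 = Suc (card E1)" using fE by (simp add: E2_def E1_def E0_def)
    ultimately have c: "card E2 = Suc m" by simp
    have "card (nbrs E2 V x) \<le> r" if x: "x \<in> V" for x
    proof -
      have le: "card (nbrs E2 V x) \<le> card (nbrs E0 V x) + (if x = u \<or> x = a then 1 else 0)
          + (if x = v \<or> x = b then 1 else 0)"
        using card_nbrs_insert_le[OF V u(1) a(1), of E0 x] card_nbrs_insert_le[OF V v(1) b(1), of E1 x]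
          a b by (simp add: E1_def E2_def)
      have le0: "card (nbrs E0 V x) \<le> d x"
        unfolding d_def using V by (intro card_mono) (auto simp: nbrs_def E0_def)
      show ?thesis
      \<comment> \<open>\<open>a\<close> and \<open>b\<close> lose one neighbour and gain one; only
        \<open>u\<close> and \<open>v\<close> grow, by two in total if they coincide.\<close>
      proof (cases "x = a \<or> x = b")
        case True
        define y where "y = (if x = a then b else a)"
        have "y \<in> nbrs E V x" using True b a by (auto simp: nbrs_def y_def insert_commute)
        moreover have "nbrs E0 V x \<subseteq> nbrs E V x - {y}"
          using True by (auto simp: nbrs_def y_def E0_def insert_commute)
        then have "card (nbrs E0 V x) \<le> card (nbrs E V x - {y})" using V by (intro card_mono) auto
        ultimately have "card (nbrs E0 V x) + 1 \<le> d x"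
          using V card_Suc_Diff1[of "nbrs E V x" y] by (simp add: d_def)
        then show ?thesis using le deg[OF x] True a av b bu ab by (auto simp: d_def)
      next
        case False
        then show ?thesis using le le0 deg[OF x] u v by (auto simp: d_def split: if_splits)
      qed
    qed
    with G2 c show ?thesis by blast
  qed
qed

text \<open>The extremal graph: a nearly \<open>(l - 1)\<close>-regular graph on \<open>X = {..<s}\<close> and an independent set
  outside, where each \<open>l\<close>-subset of \<open>X\<close> is the neighbourhood of \<open>t - 1\<close> outer vertices and all other
  outer vertices have \<open>l - 1\<close> neighbours.\<close>
lemma ex_extremal_graph:
  fixes l t s n :: nat
  assumes l: "1 \<le> l" "l \<le> s" "l \<le> t" and n: "s + (t - 1) * (s choose l) \<le> n"
  obtains E where "simple_graph_on {..<n} E" "\<not> contains_K E l t" "\<not> contains_M E (s + 1)"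
    "card E = (s * (l - 1)) div 2 + (l - 1) * (n - s) + (t - 1) * (s choose l)"
proof -
  define X Y where "X = {..<s}" and "Y = {s..<n}"
  have fX: "finite X" and fY: "finite Y" and cX: "card X = s" and cY: "card Y = n - s"
    by (auto simp: X_def Y_def)
  have XY: "X \<inter> Y = {}" "X \<union> Y = {..<n}" using n by (auto simp: X_def Y_def)
  obtain R where R: "simple_graph_on X R" "card R = (s * (l - 1)) div 2"
    and degR: "\<And>v. v \<in> X \<Longrightarrow> card (nbrs R X v) \<le> l - 1"
  proof -
    have "l - 1 < card X" "2 * ((s * (l - 1)) div 2) \<le> card X * (l - 1)" using l cX by simp_all
    from ex_graph_bounded_degree[OF fX this] that show ?thesis by blast
  qed
  define S where "S = {A. A \<subseteq> X \<and> card A = l}"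
  define P where "P = S \<times> {..<t - 1}"
  have fP: "finite P" using fX by (simp add: P_def S_def)
  have cP: "card P = (t - 1) * (s choose l)"
    using n_subsets[OF fX, of l] by (simp add: P_def S_def cX card_cartesian_product)
  then have "card P \<le> card Y" using cY n by simp
  then obtain h where h: "h ` P \<subseteq> Y" "inj_on h P"
    using card_le_inj[OF fP fY] by blast
  \<comment> \<open>\<open>h\<close> places the \<open>t - 1\<close> labelled copies of every
    \<open>l\<close>-subset on distinct outer vertices. Any other vertex gets the default set of
    size \<open>l - 1\<close>, too small to contain an \<open>l\<close>-subset.\<close>
  define N where "N v = (if v \<in> h ` P then fst (the_inv_into P h v) else {..<l - 1})" for v
  have Nh: "N (h p) = fst p" if "p \<in> P" for p
    using that h(2) by (simp add: N_def the_inv_into_f_f)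
  have NX: "N v \<subseteq> X" and cN: "card (N v) = (l - 1) + (if v \<in> h ` P then 1 else 0)" for v
  proof -
    have "N v \<subseteq> X \<and> card (N v) = (l - 1) + (if v \<in> h ` P then 1 else 0)"
    proof (cases "v \<in> h ` P")
      case True
      then obtain p where "p \<in> P" "v = h p" by blast
      then show ?thesis using Nh[of p] l(1) by (auto simp: P_def S_def)
    next
      case False
      then show ?thesis using l by (auto simp: N_def X_def)
    qed
    then show "N v \<subseteq> X" "card (N v) = (l - 1) + (if v \<in> h ` P then 1 else 0)" by auto
  qed
  have fN: "finite (N v)" for v using NX fX finite_subset by blast
  have fib: "card {v \<in> Y. N v = A} \<le> t - 1" if "card A = l" for A
  proof -
    have "{v \<in> Y. N v = A} \<subseteq> h ` ({A} \<times> {..<t - 1})"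
    proof
      fix v assume v: "v \<in> {v \<in> Y. N v = A}"
      then have "v \<in> h ` P" using cN[of v] that l(1) by (auto split: if_splits)
      then obtain p where p: "p \<in> P" "v = h p" by blast
      with v Nh have "fst p = A" by auto
      with p have "p \<in> {A} \<times> {..<t - 1}" by (auto simp: P_def)
      with p show "v \<in> h ` ({A} \<times> {..<t - 1})" by blast
    qed
    then have "card {v \<in> Y. N v = A} \<le> card (h ` ({A} \<times> {..<t - 1}))"
      by (intro card_mono) auto
    also have "\<dots> \<le> card ({A} \<times> {..<t - 1})" by (intro card_image_le) auto
    finally show ?thesis by simp
  qed
  define F where "F = (\<lambda>(v, w). {v, w}) ` Sigma Y N"
  define E where "E = R \<union> F"
  have NXY: "w \<in> X \<and> w \<notin> Y" if "w \<in> N v" for v w using that NX XY(1) by blast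
  have FD: "u \<in> X \<and> v \<in> Y \<and> u \<in> N v \<or> v \<in> X \<and> u \<in> Y \<and> v \<in> N u" if "{u, v} \<in> F" for u v
  proof -
    obtain y w where yw: "y \<in> Y" "w \<in> N y" "{u, v} = {y, w}" using \<open>{u, v} \<in> F\<close> by (auto simp: F_def)
    then have "u = y \<and> v = w \<or> u = w \<and> v = y" by (simp only: doubleton_eq_iff)
    with yw NXY show ?thesis by blast
  qed
  have EY: "u \<in> N v" if "{u, v} \<in> E" "v \<in> Y" for u v
  proof -
    have "{u, v} \<notin> R" using simple_graph_on_edge(2)[OF R(1), of u v] XY(1) that(2) by blast
    then show ?thesis using that FD[of u v] XY(1) by (auto simp: E_def)
  qed
  have EX: "{u, v} \<in> R" if "{u, v} \<in> E" "u \<in> X" "v \<in> X" for u v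
    using that FD[of u v] XY(1) by (auto simp: E_def)
  have G: "simple_graph_on {..<n} E"
    unfolding simple_graph_on_def
  proof
    fix e assume "e \<in> E"
    then consider "e \<in> R" | "e \<in> F" by (auto simp: E_def)
    then show "\<exists>u v. u \<in> {..<n} \<and> v \<in> {..<n} \<and> u \<noteq> v \<and> e = {u, v}"
    proof cases
      case 1
      with R(1) obtain u v where "u \<in> X" "v \<in> X" "u \<noteq> v" "e = {u, v}" by (rule simple_graph_onE)
      then show ?thesis using XY(2) by blast
    next
      case 2
      then obtain v w where vw: "v \<in> Y" "w \<in> N v" "e = {v, w}" by (auto simp: F_def)
      then have "v \<in> {..<n}" "w \<in> {..<n}" "v \<noteq> w" using NXY XY(2) by blast+
      with vw(3) show ?thesis by blast
    qed
  qed
  \<comment> \<open>At least \<open>l\<close> vertices of \<open>X\<close> have no common neighbour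
    in \<open>X\<close>, where degrees are at most \<open>l - 1\<close>. A common neighbour
    \<open>b\<close> in \<open>Y\<close> has at most \<open>l\<close> neighbours, so
    \<open>N b = U\<close>, and \<open>fib\<close> bounds the number of such
    \<open>b\<close>.\<close>
  have key: "card W \<le> t - 1 \<and> card U = l"
    if U: "U \<subseteq> X" "l \<le> card U" and W: "W \<noteq> {}" "\<And>a b. a \<in> U \<Longrightarrow> b \<in> W \<Longrightarrow> {a, b} \<in> E" for U W
  proof -
    have "b \<in> Y \<and> N b = U" if b: "b \<in> W" for b
    proof -
      have "U \<noteq> {}" using U l(1) by auto
      then obtain a where "a \<in> U" by blast
      then have "b \<in> {..<n}" using W(2) b simple_graph_on_edge(2)[OF G] by blast
      moreover have "b \<notin> X"
      proof
        assume bX: "b \<in> X"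
        have "U \<subseteq> nbrs R X b"
        proof
          fix a assume "a \<in> U"
          then have "{a, b} \<in> R" "a \<in> X" using EX W(2) b bX U by auto
          then show "a \<in> nbrs R X b" by (simp add: nbrs_def insert_commute)
        qed
        then have "card U \<le> card (nbrs R X b)" using fX by (intro card_mono) auto
        then show False using degR[OF bX] U l(1) by simp
      qed
      ultimately have bY: "b \<in> Y" using XY(2) by blast
      then have "U \<subseteq> N b" using EY W(2) b by blast
      moreover have "card (N b) \<le> card U" using cN[of b] U(2) l(1) by (auto split: if_splits)
      ultimately have "U = N b" using fN card_seteq by blast
      with bY show ?thesis by simp
    qed
    note b = this
    obtain b0 where "b0 \<in> W" using W(1) by blast
    then have "N b0 = U" using b by blast
    then have cU: "card U = l" using cN[of b0] U(2) l(1) by (auto split: if_splits)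
    have "card W \<le> card {v \<in> Y. N v = U}" using b fY by (intro card_mono) auto
    with fib[OF cU] cU show ?thesis by simp
  qed
  have K: "\<not> contains_K E l t"
  proof
    assume "contains_K E l t"
    then obtain A B where AB: "finite A" "finite B" "card A = l" "card B = t"
      "\<And>a b. a \<in> A \<Longrightarrow> b \<in> B \<Longrightarrow> {a, b} \<in> E"
      unfolding contains_K_def by blast
    have ne: "A \<noteq> {}" "B \<noteq> {}" using AB l by auto
    show False
    \<comment> \<open>One side of the \<open>K\<close> must lie in \<open>X\<close>, since a vertex
      in \<open>Y\<close> has all its neighbours there. If that side is \<open>B\<close>, then
      \<open>key\<close> gives \<open>t = l\<close> and \<open>l \<le> t - 1\<close> at
      once.\<close>
    proof (cases "B \<subseteq> X")
      case True
      have "{b, a} \<in> E" if "b \<in> B" "a \<in> A" for a b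
        using AB(5)[OF that(2,1)] by (simp add: insert_commute)
      then have "card A \<le> t - 1 \<and> card B = l"
        using True AB(3,4) l ne by (intro key) auto
      then show False using AB(3,4) l by linarith
    next
      case False
      then obtain b where b: "b \<in> B" "b \<notin> X" by blast
      have "b \<in> Y" using simple_graph_on_edge(2)[OF G] AB(5) b ne XY(2) by blast
      then have "A \<subseteq> X" using EY AB(5) b NX by blast
      then have "card B \<le> t - 1" using key[of A B] AB(3,5) ne(2) by simp
      then show False using AB(3,4) l by linarith
    qed
  qed
  have M: "\<not> contains_M E (s + 1)"
  proof
    assume "contains_M E (s + 1)"
    then obtain M where M: "M \<subseteq> E" "card M = s + 1" "\<forall>e\<in>M. \<forall>f\<in>M. e \<noteq> f \<longrightarrow> e \<inter> f = {}"
      unfolding contains_M_def by blast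
    \<comment> \<open>\<open>X\<close> is a vertex cover with \<open>s\<close> elements, so a
      matching injects into it.\<close>
    have "\<exists>x. x \<in> e \<inter> X" if "e \<in> M" for e
    proof -
      have "e \<in> R \<or> e \<in> F" using that M by (auto simp: E_def)
      then show ?thesis
      proof
        assume "e \<in> R"
        with R(1) obtain u v where "u \<in> X" "v \<in> X" "u \<noteq> v" "e = {u, v}" by (rule simple_graph_onE)
        then show ?thesis by blast
      next
        assume "e \<in> F"
        then obtain v w where "w \<in> N v" "e = {v, w}" by (auto simp: F_def)
        then show ?thesis using NXY by blast
      qed
    qed
    then obtain g where g: "\<And>e. e \<in> M \<Longrightarrow> g e \<in> e \<inter> X" by metis
    have "inj_on g M"
    proof (rule inj_onI)
      fix e f assume ef: "e \<in> M" "f \<in> M" "g e = g f"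
      then have "g e \<in> e \<inter> f" using g by fastforce
      then show "e = f" using M(3) ef by blast
    qed
    then have "card M \<le> card X" by (rule card_inj_on_le) (use g fX in auto)
    then show False using M cX by simp
  qed
  have "card E = card R + card F"
  proof -
    have "R \<inter> F = {}"
    proof (rule ccontr)
      assume "R \<inter> F \<noteq> {}"
      then obtain v w where "{v, w} \<in> R" "v \<in> Y" by (auto simp: F_def)
      then show False using simple_graph_on_edge(1)[OF R(1)] XY(1) by blast
    qed
    moreover have "finite R" by (rule simple_graph_on_finite[OF R(1) fX])
    moreover have "finite F" using fY fN by (simp add: F_def)
    ultimately show ?thesis by (simp add: E_def card_Un_disjoint)
  qed
  also have "card F = card (Sigma Y N)"
    unfolding F_def
  proof (rule card_image, rule inj_onI)
    fix p q assume pq: "p \<in> Sigma Y N" "q \<in> Sigma Y N"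
      "(case p of (v, w) \<Rightarrow> {v, w}) = (case q of (v, w) \<Rightarrow> {v, w})"
    obtain v w v' w' where p: "p = (v, w)" and q: "q = (v', w')" by fastforce
    have "v = v' \<and> w = w' \<or> v = w' \<and> w = v'" using pq(3) by (simp add: p q doubleton_eq_iff)
    moreover have "v \<in> Y" "w' \<notin> Y" using pq(1,2) NXY by (auto simp: p q)
    ultimately show "p = q" by (auto simp: p q)
  qed
  also have "\<dots> = (\<Sum>v\<in>Y. (l - 1) + (if v \<in> h ` P then 1 else 0))"
    using fY fN cN by (simp add: card_SigmaI)
  also have "\<dots> = (l - 1) * (n - s) + card (h ` P)"
  proof -
    have "Y \<inter> h ` P = h ` P" using h(1) by blast
    then show ?thesis using fY by (simp add: sum.distrib cY sum.If_cases)
  qed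
  finally have "card E = (s * (l - 1)) div 2 + (l - 1) * (n - s) + (t - 1) * (s choose l)"
    using R(2) card_image[OF h(2)] cP by simp
  with that G K M show ?thesis by blast
qed

section \<open>Evaluating \<open>F1\<close> and concluding\<close>

lemma ceiling_half: "\<lceil>real p / 2\<rceil> = int p - int (p div 2)"
proof -
  obtain q where "p = 2 * q \<or> p = 2 * q + 1" by (metis oddE evenE)
  then show ?thesis by (elim disjE) (simp_all add: ceiling_eq_iff)
qed

lemma F1_s:
  assumes "1 \<le> l" "1 \<le> t"
  shows "F1 n l t s s = int ((l - 1) * n + (t - 1) * (s choose l))
    - (int (s * (l - 1)) - int (s * (l - 1) div 2))"
  using assms unfolding F1_def ceiling_half by (simp add: of_nat_diff)

text \<open>With \<open>k = s - l\<close> the binomial term grows by at least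
  \<open>(t - 1) * (k * l)\<close>. This outweighs the lost \<open>k * (2 * k + 1)\<close> and the
  growth of the ceiling, which is at most \<open>k * (l - 1)\<close>.\<close>

lemma F1_mono:
  assumes "l < s" "2 * (s - l) + 1 \<le> t - 1" "3 \<le> l"
  shows "F1 n l t s l \<le> F1 n l t s s"
proof -
  define k where "k = s - l"
  have k: "s = l + k" "1 \<le> k" using assms(1) by (simp_all add: k_def)
  obtain a where a: "l = Suc a" using assms(3) by (cases l) auto
  obtain T where T: "t = Suc T" using assms(2) by (cases t) auto
  have "(2 * k + 1) * (k * l) \<le> T * (k * l)"
    using assms(2) k T by (intro mult_right_mono) auto
  moreover have "k * (2 * k + 1) + k * a \<le> (2 * k + 1) * (k * l)"
    unfolding a by (simp add: algebra_simps)
  moreover have "T * (1 + k * l) \<le> T * (s choose l)"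
    using choose_add_ge[of l l k] assms(3) k by (intro mult_left_mono) auto
  ultimately have 1: "T + k * (2 * k + 1) + k * a \<le> T * (s choose l)" by simp
  have c2: "(2 * (s - l) + 1) choose 2 = k * (2 * k + 1)" using k by (simp add: choose_two)
  have 2: "s * a = l * a + k * a" using k by (simp add: algebra_simps)
  have "int T + int (k * (2 * k + 1)) - (int (l * a) - int (l * a div 2))
      \<le> int (T * (s choose l)) - (int (s * a) - int (s * a div 2))"
    using 1 2 by linarith
  then show ?thesis
    unfolding F1_def ceiling_half c2 by (simp add: a T)
qed

theorem theorem3p7:
  fixes l t s n :: nat
  assumes "2 * l + 2 \<le> 2 * s" and "2 * s \<le> 2 * l + t - 2"
    and "l \<ge> 3" and "t \<ge> 4" and "t \<ge> l"
    and "n \<ge> max (2 * ((3 * s) choose 2)) (s + (t - 1) * (s choose l) + 1)"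
  shows "int (ex_KM n l t (s + 1)) = max (F1 n l t s l) (F1 n l t s s)"
proof -
  have ls: "l < s" and st: "2 * (s - l) + 1 \<le> t - 1" using assms(1-4) by linarith+
  have n: "s + (t - 1) * (s choose l) \<le> n" using assms(6) by simp
  \<comment> \<open>Evenness makes the halving in \<open>choose_two\<close> exact, so the hypothesis
    on \<open>n\<close> reads \<open>n \<ge> 9 * (s * s) - 3 * s\<close>.\<close>
  have "even (3 * s * (3 * s - 1))" by (cases s) simp_all
  then have "2 * ((3 * s) choose 2) = 3 * s * (3 * s - 1)"
    unfolding choose_two by (rule dvd_mult_div_cancel)
  also have "\<dots> + 3 * s = 9 * (s * s)" by (cases s) (simp_all add: algebra_simps)
  finally have n9: "9 * (s * s) \<le> n + 3 * s" using assms(6) by simp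
  define p where "p = s * (l - 1)"
  define \<E> where
    "\<E> = {card E | E. simple_graph_on {..<n} E \<and> \<not> contains_K E l t \<and> \<not> contains_M E (s + 1)}"
  obtain E0 where E0: "simple_graph_on {..<n} E0" "\<not> contains_K E0 l t" "\<not> contains_M E0 (s + 1)"
    and c0: "card E0 = p div 2 + (l - 1) * (n - s) + (t - 1) * (s choose l)"
    using ex_extremal_graph[of l s t n] assms ls n unfolding p_def by auto
  have "(l - 1) * n = (l - 1) * (n - s) + p"
  proof -
    have "n = (n - s) + s" using n by simp
    then show ?thesis unfolding p_def by (metis add_mult_distrib2 mult.commute)
  qed
  then have c0': "card E0 + p = (l - 1) * n + (t - 1) * (s choose l) + p div 2" using c0 by simp
  have upper: "card E \<le> card E0"
    if E: "simple_graph_on {..<n} E" "\<not> contains_K E l t" "\<not> contains_M E (s + 1)" for E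
  proof -
    have "2 * card E + p \<le> 2 * ((l - 1) * n) + 2 * ((t - 1) * (s choose l))"
      using edges_le_of_K_M_free[OF E(1) _ E(2,3) ls st assms(3)] n9
      by (simp add: p_def mult.assoc)
    \<comment> \<open>Halving bounds \<open>card E\<close> by \<open>card E0\<close> up to at most
      one half, which integrality removes.\<close>
    then show ?thesis using c0' by linarith
  qed
  have "Max \<E> = card E0"
  proof (rule Max_eqI)
    show "finite \<E>" by (rule finite_subset[of _ "{..card E0}"]) (use upper in \<open>auto simp: \<E>_def\<close>)
  qed (use upper E0 in \<open>auto simp: \<E>_def\<close>)
  then have "ex_KM n l t (s + 1) = card E0" by (simp add: ex_KM_def \<E>_def)
  also have "int \<dots> = F1 n l t s s"
    using F1_s[of l t n s] c0' assms(3,4) unfolding p_def[symmetric] by linarith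
  finally show ?thesis using F1_mono[OF ls st assms(3), of n] by simp
qed

end
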